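(* For every bipartite graph $G$, there exists an integer $k \geq 1$ such that $G$ is $C_{2k+1}$-mixing.
   Context: Graphs are finite and simple. $C_n$ is the cycle on $n$ vertices. A graph $G$ is $H$-mixing if any two homomorphisms $G \to H$ are joined by a finite sequence of homomorphisms $G\to H$ in which consecutive homomorphisms differ on at most one vertex of $G$. *)

theory Defs
  imports Graph_Theory.Pair_Digraph "HOL-Library.FuncSet"
begin

text \<open>
  Finite simple graphs are the finite, loopfree, symmetric digraphs of locale
  \<open>pair_graph\<close>: an undirected edge is a pair of opposite arcs.
\<close>

definition bipartite :: "'a pair_pre_digraph \<Rightarrow> bool" where
  "bipartite G \<longleftrightarrow> (\<exists>A B. pverts G = A \<union> B \<and> A \<inter> B = {} \<and>
     (\<forall>(u, v) \<in> parcs G. u \<in> A \<and> v \<in> B \<or> u \<in> B \<and> v \<in> A))"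

text \<open>The cycle on the residues modulo \<open>n\<close>; this is a simple graph only for \<open>n \<ge> 3\<close>.\<close>

definition cycle_graph :: "nat \<Rightarrow> nat pair_pre_digraph" where
  "cycle_graph n = \<lparr> pverts = {0..<n},
     parcs = {(i, j). i < n \<and> j < n \<and> (j = (i + 1) mod n \<or> i = (j + 1) mod n)} \<rparr>"

lemma pair_graph_cycle_graph:
  assumes "n \<ge> 3"
  shows "pair_graph (cycle_graph n)"
proof
  show "finite (pverts (cycle_graph n))"
    by (simp add: cycle_graph_def)
  show "finite (parcs (cycle_graph n))"
    by (rule finite_subset[of _ "{0..<n} \<times> {0..<n}"]) (auto simp: cycle_graph_def)
  show "symmetric (with_proj (cycle_graph n))"
    by (auto simp: symmetric_def cycle_graph_def intro!: symI)
next
  fix e assume e: "e \<in> parcs (cycle_graph n)"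
  show "fst e \<in> pverts (cycle_graph n)" "snd e \<in> pverts (cycle_graph n)"
    using e by (auto simp: cycle_graph_def)
  show "fst e \<noteq> snd e"
    using e assms by (auto simp: cycle_graph_def mod_Suc split: if_splits)
qed

text \<open>
  Homomorphisms are taken extensional, so that they are equal as HOL functions iff they
  agree on all vertices of \<open>G\<close>.
\<close>

definition graph_homs :: "'a pair_pre_digraph \<Rightarrow> 'b pair_pre_digraph \<Rightarrow> ('a \<Rightarrow> 'b) set" where
  "graph_homs G H = {f \<in> pverts G \<rightarrow>\<^sub>E pverts H. \<forall>(u, v) \<in> parcs G. (f u, f v) \<in> parcs H}"

definition recolouring_step ::
  "'a pair_pre_digraph \<Rightarrow> 'b pair_pre_digraph \<Rightarrow> (('a \<Rightarrow> 'b) \<times> ('a \<Rightarrow> 'b)) set" where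
  "recolouring_step G H = {(f, g). f \<in> graph_homs G H \<and> g \<in> graph_homs G H \<and>
     (\<exists>x. \<forall>v \<in> pverts G. v \<noteq> x \<longrightarrow> f v = g v)}"

definition mixing :: "'b pair_pre_digraph \<Rightarrow> 'a pair_pre_digraph \<Rightarrow> bool" where
  "mixing H G \<longleftrightarrow>
     (\<forall>f \<in> graph_homs G H. \<forall>g \<in> graph_homs G H. (f, g) \<in> (recolouring_step G H)\<^sup>*)"

end

theory Submission
  imports Defs
begin

text \<open>
  If \<open>N > |V(G)|\<close> is odd, no homomorphism \<open>G \<rightarrow> C\<^sub>N\<close> is surjective, so each one maps into a path
  and hence lifts to a height function \<open>h : V(G) \<rightarrow> \<int>\<close> that changes by exactly 1 along every edge.
  As \<open>N\<close> is odd, adding \<open>N\<close> at the vertices where it is needed makes the parity of \<open>h\<close> agree with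
  the bipartition. Moving an extremal height by 2 towards \<open>{0, 1}\<close> is a recolouring step, and
  repeating this ends at the indicator function of one side of the bipartition.
\<close>

text \<open>The parity condition links the heights to one side of the bipartition, so on the
  vertices only one height takes all its values in {0, 1}. Every reduction of heights can therefore
  aim at the same end point.\<close>

definition height :: "'a pair_pre_digraph \<Rightarrow> 'a set \<Rightarrow> ('a \<Rightarrow> int) \<Rightarrow> bool" where
  "height G A h \<longleftrightarrow> (\<forall>(u, v) \<in> parcs G. \<bar>h u - h v\<bar> = 1) \<and> (\<forall>v \<in> pverts G. even (h v) \<longleftrightarrow> v \<in> A)"

definition reduce :: "'a pair_pre_digraph \<Rightarrow> nat \<Rightarrow> ('a \<Rightarrow> int) \<Rightarrow> 'a \<Rightarrow> nat" where
  "reduce G N h = (\<lambda>v \<in> pverts G. nat (h v mod int N))"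

lemma cycle_graph_arc_mod:
  fixes a b :: int
  assumes N: "N > 0" and ab: "\<bar>a - b\<bar> = 1"
  shows "(nat (a mod int N), nat (b mod int N)) \<in> parcs (cycle_graph N)"
proof -
  have succ: "nat ((x + 1) mod int N) = (nat (x mod int N) + 1) mod N" for x :: int
  proof -
    have "int (nat ((x + 1) mod int N)) = (x + 1) mod int N"
      using N by simp
    also have "\<dots> = (x mod int N + 1) mod int N"
      by (simp add: mod_add_left_eq)
    also have "\<dots> = int ((nat (x mod int N) + 1) mod N)"
      using N by (simp add: zmod_int add.commute)
    finally show ?thesis
      by linarith
  qed
  have bound: "nat (x mod int N) < N" for x :: int
    using N by (simp add: nat_less_iff)
  consider "b = a + 1" | "a = b + 1"
    using ab by linarith
  then show ?thesis
    by cases (simp_all add: cycle_graph_def succ bound N del: One_nat_def)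
qed

lemma reduce_in_graph_homs:
  assumes "pair_graph G" "N > 0" "height G A h"
  shows "reduce G N h \<in> graph_homs G (cycle_graph N)"
proof -
  interpret pair_graph G by fact
  have "(reduce G N h u, reduce G N h v) \<in> parcs (cycle_graph N)" if "(u, v) \<in> parcs G" for u v
  proof -
    have "u \<in> pverts G" "v \<in> pverts G"
      using that wellformed[of "(u, v)"] by auto
    moreover have "\<bar>h u - h v\<bar> = 1"
      using assms(3) that by (auto simp: height_def)
    ultimately show ?thesis
      using cycle_graph_arc_mod[OF assms(2)] by (simp add: reduce_def)
  qed
  moreover have "reduce G N h \<in> pverts G \<rightarrow>\<^sub>E pverts (cycle_graph N)"
    using assms(2) by (auto simp: reduce_def cycle_graph_def nat_less_iff)
  ultimately show ?thesis
    by (auto simp: graph_homs_def)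
qed

text \<open>Induction on the sum of \<bar>2 * h v - 1\<bar>, where each term is twice the distance
  of \<open>h v\<close> from 1/2. It is smallest exactly on {0, 1}, and a vertex farthest from 1/2
  can always be moved closer.\<close>

lemma recolouring_reduce_indicator:
  assumes G: "pair_graph G" and N: "N > 0" and h: "height G A h"
  shows "(reduce G N h, reduce G N (\<lambda>v. if v \<in> A then 0 else 1))
    \<in> (recolouring_step G (cycle_graph N))\<^sup>*"
  using h
proof (induction "\<Sum>v \<in> pverts G. nat \<bar>2 * h v - 1\<bar>" arbitrary: h rule: less_induct)
  case less
  interpret pair_graph G by fact
  have step1: "\<bar>h u - h v\<bar> = 1" if "(u, v) \<in> parcs G" for u v
    using less.prems that by (auto simp: height_def)
  have par: "even (h v) \<longleftrightarrow> v \<in> A" if "v \<in> pverts G" for v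
    using less.prems that by (auto simp: height_def)
  show ?case
  proof (cases "\<forall>v \<in> pverts G. h v \<in> {0, 1}")
    case True
    then have "h v = (if v \<in> A then 0 else 1)" if "v \<in> pverts G" for v
      using that par[OF that] by fastforce
    then have "reduce G N h = reduce G N (\<lambda>v. if v \<in> A then 0 else 1)"
      unfolding reduce_def by (intro restrict_ext) simp
    then show ?thesis
      by simp
  next
    case False
    then obtain z where z: "z \<in> pverts G" "h z \<notin> {0, 1}"
      by auto
    let ?D = "(\<lambda>u. \<bar>2 * h u - 1\<bar>) ` pverts G"
    have "Max ?D \<in> ?D"
      using z(1) by (intro Max_in) auto
    then obtain v where v: "v \<in> pverts G" and "Max ?D = \<bar>2 * h v - 1\<bar>"
      by auto
    then have max: "\<bar>2 * h u - 1\<bar> \<le> \<bar>2 * h v - 1\<bar>" if "u \<in> pverts G" for u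
      using that Max_ge[of ?D] by fastforce
    \<comment> \<open>A move by 2 preserves parity, and its direction is towards {0, 1}.\<close>
    define w where "w = (if h v \<ge> 2 then h v - 2 else h v + 2)"
    have out: "h v \<ge> 2 \<or> h v \<le> -1"
      using max[OF z(1)] z(2) by auto
    \<comment> \<open>By maximality of \<open>v\<close>, no neighbour lies farther from 1/2, so all
      neighbours have the height halfway between \<open>h v\<close> and \<open>w\<close>.\<close>
    have nbr: "\<bar>h u - w\<bar> = 1" if "u \<in> pverts G" "\<bar>h u - h v\<bar> = 1" for u
      using max[OF that(1)] that(2) out by (auto simp: w_def abs_if split: if_splits)
    let ?h = "h(v := w)"
    have h': "height G A ?h"
      unfolding height_def
    proof (intro conjI ballI)
      fix e assume e: "e \<in> parcs G"
      obtain a b where ab: "e = (a, b)" by (cases e)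
      have "a \<in> pverts G" "b \<in> pverts G" "a \<noteq> b"
        using e ab wellformed[of e] no_loops[of e] by auto
      then show "case e of (a, b) \<Rightarrow> \<bar>?h a - ?h b\<bar> = 1"
        using step1[of a b] e ab nbr[of a] nbr[of b] by (auto simp: abs_minus_commute)
    next
      fix u assume "u \<in> pverts G"
      then show "even (?h u) \<longleftrightarrow> u \<in> A"
        using par[of u] by (auto simp: w_def)
    qed
    have "(\<Sum>u \<in> pverts G. nat \<bar>2 * ?h u - 1\<bar>) < (\<Sum>u \<in> pverts G. nat \<bar>2 * h u - 1\<bar>)"
      using out v by (intro sum_strict_mono_ex1) (auto simp: w_def intro!: bexI[of _ v])
    then have "(reduce G N ?h, reduce G N (\<lambda>v. if v \<in> A then 0 else 1))
        \<in> (recolouring_step G (cycle_graph N))\<^sup>*"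
      using less.hyps h' by blast
    moreover have "(reduce G N h, reduce G N ?h) \<in> recolouring_step G (cycle_graph N)"
      using reduce_in_graph_homs[OF G N less.prems] reduce_in_graph_homs[OF G N h']
      by (auto simp: recolouring_step_def reduce_def intro!: exI[of _ v])
    ultimately show ?thesis
      by (rule converse_rtrancl_into_rtrancl[rotated])
  qed
qed

text \<open>Cutting the cycle at a missed colour leaves a path, which embeds in the integers. Since
  \<open>N\<close> is odd, a shift by \<open>N\<close> flips parity without changing the
  residue.\<close>

lemma exists_height_lift:
  assumes G: "pair_graph G" and N: "odd N" "card (pverts G) < N"
    and A: "\<forall>(u, v) \<in> parcs G. u \<in> A \<longleftrightarrow> v \<notin> A"
    and f: "f \<in> graph_homs G (cycle_graph N)"
  obtains h where "height G A h" "reduce G N h = f"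
proof -
  interpret pair_graph G by fact
  have f_lt: "f v < N" if "v \<in> pverts G" for v
    using f that by (auto simp: graph_homs_def cycle_graph_def)
  have "card (f ` pverts G) < card {..<N}"
    using N(2) card_image_le[OF pair_finite_verts, of f] by simp
  then have "\<not> {..<N} \<subseteq> f ` pverts G"
    by (metis card_mono finite_imageI not_less pair_finite_verts)
  then obtain c where c: "c < N" "c \<notin> f ` pverts G"
    by auto
  \<comment> \<open>Reads the path from c + 1 up to N - 1, then on through N (colour 0) to N + c -
    1, so the edge between colours N - 1 and 0 also becomes a unit step.\<close>
  define g where "g v = (if f v > c then int (f v) else int (f v) + int N)" for v
  define h where "h v = (if even (g v) \<longleftrightarrow> v \<in> A then g v else g v + int N)" for v
  have g: "\<bar>g u - g v\<bar> = 1" if uv: "(u, v) \<in> parcs G" for u v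
  proof -
    have "u \<in> pverts G" "v \<in> pverts G"
      using uv wellformed[of "(u, v)"] by auto
    then have ne: "f u \<noteq> c" "f v \<noteq> c" and lt: "f u < N" "f v < N"
      using c f_lt by auto
    have "(f u, f v) \<in> parcs (cycle_graph N)"
      using f uv by (auto simp: graph_homs_def)
    then have "f v = (f u + 1) mod N \<or> f u = (f v + 1) mod N"
      by (auto simp: cycle_graph_def)
    then have "f v = f u + 1 \<or> f u = f v + 1 \<or> f v = 0 \<and> f u + 1 = N \<or> f u = 0 \<and> f v + 1 = N"
      using lt by (auto simp: mod_Suc split: if_splits)
    then show ?thesis
      using ne lt c(1) unfolding g_def by auto
  qed
  have "\<bar>h u - h v\<bar> = 1" if uv: "(u, v) \<in> parcs G" for u v
  proof -
    \<comment> \<open>Along an edge both the parity of \<open>g\<close> and membership in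
      \<open>A\<close> flip, so both ends are shifted by \<open>N\<close> or neither is, and the
      difference survives.\<close>
    have "even (g u) \<longleftrightarrow> odd (g v)"
      using g[OF uv] by presburger
    moreover have "u \<in> A \<longleftrightarrow> v \<notin> A"
      using A uv by auto
    ultimately show ?thesis
      using g[OF uv] by (auto simp: h_def)
  qed
  moreover have "even (h v) \<longleftrightarrow> v \<in> A" for v
    using N(1) by (auto simp: h_def)
  ultimately have "height G A h"
    by (auto simp: height_def)
  moreover have "reduce G N h = f"
  proof
    fix v
    show "reduce G N h v = f v"
    proof (cases "v \<in> pverts G")
      case True
      have "h v mod int N = int (f v)"
        using f_lt[OF True] by (auto simp: h_def g_def)
      then show ?thesis
        using True by (simp add: reduce_def)
    next
      case False
      then show ?thesis
        using f by (auto simp: reduce_def graph_homs_def)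
    qed
  qed
  ultimately show thesis
    by (rule that)
qed

lemma sym_recolouring_step: "sym (recolouring_step G H)"
  by (rule symI) (fastforce simp: recolouring_step_def)

theorem theorem2p7:
  fixes G :: "'a pair_pre_digraph"
  assumes "pair_graph G" and "bipartite G"
  shows "\<exists>k::nat. k \<ge> 1 \<and> mixing (cycle_graph (2 * k + 1)) G"
proof -
  obtain A B where AB: "A \<inter> B = {}"
    and arcs: "\<forall>(u, v) \<in> parcs G. u \<in> A \<and> v \<in> B \<or> u \<in> B \<and> v \<in> A"
    using assms(2) by (auto simp: bipartite_def)
  have A: "\<forall>(u, v) \<in> parcs G. u \<in> A \<longleftrightarrow> v \<notin> A"
    using AB arcs by blast
  \<comment> \<open>The summand 1 secures k \<ge> 1 even for the empty graph.\<close>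
  define k where "k = card (pverts G) + 1"
  define N where "N = 2 * k + 1"
  let ?R = "(recolouring_step G (cycle_graph N))\<^sup>*"
  let ?i = "reduce G N (\<lambda>v. if v \<in> A then 0 else 1)"
  have N: "odd N" "card (pverts G) < N"
    by (auto simp: N_def k_def)
  have to_i: "(f, ?i) \<in> ?R" if f: "f \<in> graph_homs G (cycle_graph N)" for f
  proof -
    obtain h where "height G A h" "reduce G N h = f"
      using exists_height_lift[OF assms(1) N A f] .
    then show ?thesis
      using recolouring_reduce_indicator[OF assms(1)] N(2) by fastforce
  qed
  have "mixing (cycle_graph N) G"
    unfolding mixing_def
  proof (intro ballI)
    fix f g assume "f \<in> graph_homs G (cycle_graph N)" "g \<in> graph_homs G (cycle_graph N)"
    then have "(f, ?i) \<in> ?R" "(?i, g) \<in> ?R"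
      \<comment> \<open>Both homomorphisms reach \<open>?i\<close>; the path from \<open>g\<close>
        is walked backwards.\<close>
      using to_i symD[OF sym_rtrancl[OF sym_recolouring_step]] by blast+
    then show "(f, g) \<in> ?R"
      by (rule rtrancl_trans)
  qed
  moreover have "k \<ge> 1"
    by (simp add: k_def)
  ultimately show ?thesis
    unfolding N_def by blast
qed

end
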